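(* Let $p,q\in\mathbb{N}$ and $\mathbf{n}\in\mathbb{N}^q$. A $(p,\mathbf{n})$-system of shadows is realistic if and only if it is realisable.
   Context: For $\mathbf{n}=(n_1,\dots,n_q)\in\mathbb{N}^q$ let $[\mathbf{n}]=[n_1]\times\dots\times[n_q]$ (with $[m]=\{1,\dots,m\}$), and let $\mathcal{T}^{\mathbf{n}}(\mathbb{Z})$ be the set of functions $[\mathbf{n}]\to\mathbb{Z}$. For a tuple $\mathbf{b}=(b_1,\dots,b_q)$ and $\mathbf{i}=(i_1,\dots,i_r)\in[q]^r$ set $\mathbf{b}_{\mathbf{i}}=(b_{i_1},\dots,b_{i_r})$; for $r=0$ this is the empty tuple $\epsilon$, and $[\epsilon]=\{\epsilon\}$, so a tensor with zero modes is just an integer. For $T\in\mathcal{T}^{\mathbf{n}}(\mathbb{Z})$ and $\mathbf{i}\in[q]^r$, the projection $\Pi^{\mathbf{n}}_{\mathbf{i}}*T\in\mathcal{T}^{\mathbf{n}_{\mathbf{i}}}(\mathbb{Z})$ is defined by $(\Pi^{\mathbf{n}}_{\mathbf{i}}*T)(\mathbf{a})=\sum_{\mathbf{b}\in[\mathbf{n}],\ \mathbf{b}_{\mathbf{i}}=\mathbf{a}}T(\mathbf{b})$ (so $\Pi^{\mathbf{n}}_{\epsilon}*T$ is the sum of all entries of $T$). Let $[q]^p_\to$ be the set of strictly increasing tuples in $[q]^p$ ($[q]^0_\to=\{\epsilon\}$). A $(p,\mathbf{n})$-system of shadows is a family $\mathcal{S}=\{S_{\mathbf{i}}\}_{\mathbf{i}\in[q]^p_\to}$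 with $S_{\mathbf{i}}\in\mathcal{T}^{\mathbf{n}_{\mathbf{i}}}(\mathbb{Z})$. It is realistic if $\Pi^{\mathbf{n}_{\mathbf{i}}}_{\mathbf{r}}*S_{\mathbf{i}}=\Pi^{\mathbf{n}_{\mathbf{j}}}_{\mathbf{s}}*S_{\mathbf{j}}$ for all $\mathbf{i},\mathbf{j}\in[q]^p_\to$ and $\mathbf{r},\mathbf{s}\in[p]^{p-1}_\to$ with $\mathbf{i}_{\mathbf{r}}=\mathbf{j}_{\mathbf{s}}$. It is realisable if there exists $C\in\mathcal{T}^{\mathbf{n}}(\mathbb{Z})$ with $\Pi^{\mathbf{n}}_{\mathbf{i}}*C=S_{\mathbf{i}}$ for all $\mathbf{i}\in[q]^p_\to$. *)

theory Defs
  imports Main "HOL-Library.FuncSet"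
begin

text \<open>Tuples of positive integers are lists of naturals. As in the mathematics, all indices are
  1-based, whereas list access is 0-based; hence the shift in \<open>subtuple\<close>. The positive integer
  \<open>q\<close> attached to a size vector \<open>n\<close> is \<open>length n\<close>.\<close>

definition box :: "nat list \<Rightarrow> nat list set" where
  "box n = {b. length b = length n \<and> (\<forall>k<length n. b ! k \<in> {1..n ! k})}"

definition tensors :: "nat list \<Rightarrow> (nat list \<Rightarrow> int) set" where
  "tensors n = (box n \<rightarrow>\<^sub>E UNIV)"

definition subtuple :: "nat list \<Rightarrow> nat list \<Rightarrow> nat list" where
  "subtuple b i = map (\<lambda>k. b ! (k - 1)) i"

definition proj :: "nat list \<Rightarrow> nat list \<Rightarrow> (nat list \<Rightarrow> int) \<Rightarrow> nat list \<Rightarrow> int" where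
  "proj n i T =
     (\<lambda>a\<in>box (subtuple n i). \<Sum>b\<in>{b \<in> box n. subtuple b i = a}. T b)"

definition increasing_tuples :: "nat \<Rightarrow> nat \<Rightarrow> nat list set" where
  "increasing_tuples q p = {i. length i = p \<and> set i \<subseteq> {1..q} \<and> sorted_wrt (<) i}"

definition shadow_systems :: "nat \<Rightarrow> nat list \<Rightarrow> (nat list \<Rightarrow> nat list \<Rightarrow> int) set" where
  "shadow_systems p n = (\<Pi>\<^sub>E i\<in>increasing_tuples (length n) p. tensors (subtuple n i))"

text \<open>\<open>realistic\<close> is meant for \<open>p \<ge> 1\<close>, where \<open>p - 1\<close> is true subtraction.\<close>

definition realistic :: "nat \<Rightarrow> nat list \<Rightarrow> (nat list \<Rightarrow> nat list \<Rightarrow> int) \<Rightarrow> bool" where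
  "realistic p n S \<longleftrightarrow>
     (\<forall>i\<in>increasing_tuples (length n) p. \<forall>j\<in>increasing_tuples (length n) p.
      \<forall>r\<in>increasing_tuples p (p - 1). \<forall>s\<in>increasing_tuples p (p - 1).
        subtuple i r = subtuple j s \<longrightarrow>
        proj (subtuple n i) r (S i) = proj (subtuple n j) s (S j))"

definition realisable :: "nat \<Rightarrow> nat list \<Rightarrow> (nat list \<Rightarrow> nat list \<Rightarrow> int) \<Rightarrow> bool" where
  "realisable p n S \<longleftrightarrow>
     (\<exists>C\<in>tensors n. \<forall>i\<in>increasing_tuples (length n) p. proj n i C = S i)"

end

theory Submission
  imports Defs
begin

text \<open>
  Realisable systems are realistic because projections compose. For the converse, induct on \<open>p\<close>,
  starting from \<open>p = 0\<close>. The \<open>p\<close>-dimensional marginals of a realistic \<open>(p + 1)\<close>-system are well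
  defined and again realistic, because two \<open>p\<close>-subsets sharing \<open>p - 1\<close> elements lie in a common
  \<open>(p + 1)\<close>-subset; so they are realised by some tensor \<open>C\<close>. The defects
  \<open>D\<^sub>i = S\<^sub>i - \<Pi>\<^sub>i * C\<close> then have vanishing \<open>p\<close>-dimensional marginals. Supporting \<open>D\<^sub>i\<close> on the entries
  whose coordinates outside \<open>i\<close> all equal 1 gives a tensor with projection \<open>D\<^sub>i\<close> along \<open>i\<close> and
  zero along every other \<open>i'\<close>, and adding all of these to \<open>C\<close> realises \<open>S\<close>.
\<close>

subsection \<open>Boxes and increasing tuples\<close>

lemma length_subtuple [simp]: "length (subtuple b i) = length i"
  by (simp add: subtuple_def)

lemma nth_subtuple [simp]: "k < length i \<Longrightarrow> subtuple b i ! k = b ! (i ! k - 1)"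
  by (simp add: subtuple_def)

lemma subtuple_subtuple:
  assumes "set r \<subseteq> {1..length i}"
  shows "subtuple (subtuple b i) r = subtuple b (subtuple i r)"
proof (rule nth_equalityI)
  fix k assume "k < length (subtuple (subtuple b i) r)"
  then have k: "k < length r" by simp
  then have "r ! k \<in> {1..length i}" using assms nth_mem by blast
  then have "r ! k - 1 < length i" by auto
  then show "subtuple (subtuple b i) r ! k = subtuple b (subtuple i r) ! k"
    using k by simp
qed simp

lemma finite_box [simp]: "finite (box n)"
proof (rule finite_subset)
  show "box n \<subseteq> {b. set b \<subseteq> {1..Max (set n)} \<and> length b = length n}"
  proof
    fix b assume b: "b \<in> box n"
    have "x \<in> {1..Max (set n)}" if x: "x \<in> set b" for x
    proof -
      obtain k where k: "k < length b" "b ! k = x"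
        using x by (auto simp: in_set_conv_nth)
      then have "k < length n" using b by (simp add: box_def)
      moreover from this have "b ! k \<in> {1..n ! k}" using b by (simp add: box_def)
      moreover from \<open>k < length n\<close> have "n ! k \<le> Max (set n)" by (intro Max_ge) simp_all
      ultimately show ?thesis using k by (metis atLeastAtMost_iff order_trans)
    qed
    then show "b \<in> {b. set b \<subseteq> {1..Max (set n)} \<and> length b = length n}"
      using b by (auto simp: box_def)
  qed
  show "finite {b. set b \<subseteq> {1..Max (set n)} \<and> length b = length n}"
    by (rule finite_lists_length_eq) simp
qed

lemma subtuple_in_box:
  assumes "b \<in> box n" "set i \<subseteq> {1..length n}"
  shows "subtuple b i \<in> box (subtuple n i)"
proof -
  have "b ! (i ! k - 1) \<in> {1..n ! (i ! k - 1)}" if "k < length i" for k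
  proof -
    have "i ! k \<in> {1..length n}" using that assms(2) nth_mem by blast
    then have "i ! k - 1 < length n" by auto
    then show ?thesis using assms(1) by (auto simp: box_def)
  qed
  then show ?thesis by (auto simp: box_def)
qed

lemma list_update_in_box:
  assumes "b \<in> box n" "x \<in> {1..n ! k}"
  shows "b[k := x] \<in> box n"
proof -
  have "b[k := x] ! l \<in> {1..n ! l}" if "l < length n" for l
    using assms that by (cases "l = k") (auto simp: box_def)
  then show ?thesis using assms(1) by (simp add: box_def)
qed

lemma increasing_tuplesD:
  assumes "i \<in> increasing_tuples q p"
  shows "length i = p" "set i \<subseteq> {1..q}" "sorted_wrt (<) i" "distinct i"
  using assms by (auto simp: increasing_tuples_def strict_sorted_iff)

lemma finite_increasing_tuples [simp]: "finite (increasing_tuples q p)"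
  by (rule finite_subset[OF _ finite_lists_length_eq[of "{1..q}" p]])
    (auto simp: increasing_tuples_def)

text \<open>Increasing tuples act as names for subsets of \<open>{1..q}\<close>. Together with
  \<open>increasing_tuple_of_set\<close> and \<open>subtuple_of_subset\<close>, this lets later
  arguments compare and count entry sets instead of tuples.\<close>

lemma increasing_tuples_eqI:
  assumes "i \<in> increasing_tuples q p" "j \<in> increasing_tuples q p'" "set i = set j"
  shows "i = j"
  using assms by (auto simp: increasing_tuples_def intro: strict_sorted_equal)

lemma increasing_tuple_of_set:
  assumes "A \<subseteq> {1..q}"
  shows "sorted_list_of_set A \<in> increasing_tuples q (card A)"
  using assms finite_subset[OF assms] by (auto simp: increasing_tuples_def)

lemma subtuple_increasing:
  assumes "i \<in> increasing_tuples q p" "r \<in> increasing_tuples p m"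
  shows "subtuple i r \<in> increasing_tuples q m"
proof -
  note i = increasing_tuplesD[OF assms(1)] and r = increasing_tuplesD[OF assms(2)]
  have pos: "1 \<le> r ! k \<and> r ! k - 1 < length i" if "k < length r" for k
  proof -
    have "r ! k \<in> {1..p}" using that r(2) nth_mem by blast
    then show ?thesis using i(1) by auto
  qed
  have "set (subtuple i r) \<subseteq> {1..q}"
  proof -
    have "i ! (t - 1) \<in> {1..q}" if "t \<in> set r" for t
    proof -
      have "t - 1 < length i" using that r(2) i(1) by force
      then show ?thesis using i(2) nth_mem by blast
    qed
    then show ?thesis by (auto simp: subtuple_def)
  qed
  moreover have "sorted_wrt (<) (subtuple i r)"
    unfolding sorted_wrt_iff_nth_less
  proof (intro allI impI)
    fix a b assume ab: "a < b" "b < length (subtuple i r)"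
    then have "r ! a < r ! b" using r(3) by (simp add: sorted_wrt_iff_nth_less)
    \<comment> \<open>That \<open>r ! a\<close> is at least 1 matters here: truncated subtraction of
      1 is strictly monotone only from 1 onwards.\<close>
    then have "r ! a - 1 < r ! b - 1" using pos[of a] ab by (intro diff_less_mono) auto
    then have "i ! (r ! a - 1) < i ! (r ! b - 1)"
      using i(3) pos[of b] ab by (simp add: sorted_wrt_iff_nth_less)
    then show "subtuple i r ! a < subtuple i r ! b" using ab by simp
  qed
  ultimately show ?thesis using r(1) by (simp add: increasing_tuples_def)
qed

text \<open>In a distinct tuple an entry determines its position. The range conditions keep all
  positions at least 1, so nothing is lost in the shift by 1.\<close>

lemma subtuple_cancel:
  assumes "distinct i" "set r \<subseteq> {1..length i}" "set s \<subseteq> {1..length i}"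
    and "subtuple i r = subtuple i s"
  shows "r = s"
proof (rule nth_equalityI)
  show len: "length r = length s" using assms(4) by (metis length_subtuple)
  fix k assume k: "k < length r"
  have "r ! k \<in> {1..length i}" "s ! k \<in> {1..length i}"
    using k len assms(2,3) nth_mem by (blast, metis subsetD)
  moreover have "i ! (r ! k - 1) = i ! (s ! k - 1)"
    using assms(4) k len by (metis nth_subtuple)
  ultimately have "r ! k - 1 = s ! k - 1"
    using assms(1) by (subst (asm) nth_eq_iff_index_eq) auto
  then show "r ! k = s ! k"
    using \<open>r ! k \<in> _\<close> \<open>s ! k \<in> _\<close> by auto
qed

lemma subtuple_of_subset:
  assumes "i \<in> increasing_tuples q p" "j \<in> increasing_tuples q m" "set j \<subseteq> set i"
  obtains r where "r \<in> increasing_tuples p m" "subtuple i r = j"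
proof
  note i = increasing_tuplesD[OF assms(1)] and j = increasing_tuplesD[OF assms(2)]
  \<comment> \<open>The positions in \<open>i\<close> of the entries of \<open>j\<close>, in
    ascending order; \<open>Suc\<close> turns list positions into 1-based indices.\<close>
  define r where "r = map Suc (filter (\<lambda>t. i ! t \<in> set j) [0..<length i])"
  have "subtuple i r = map ((!) i) (filter (\<lambda>t. i ! t \<in> set j) [0..<length i])"
    by (simp add: subtuple_def r_def comp_def)
  also have "\<dots> = filter (\<lambda>x. x \<in> set j) (map ((!) i) [0..<length i])"
    by (simp add: filter_map comp_def)
  also have "\<dots> = filter (\<lambda>x. x \<in> set j) i" by (simp add: map_nth)
  also have "\<dots> = j"
    using assms(3) i(3) j(3)
    by (intro strict_sorted_equal) (auto intro: sorted_wrt_filter)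
  finally show sub: "subtuple i r = j" .
  have "length r = m" using sub j(1) by (metis length_subtuple)
  moreover have "set r \<subseteq> {1..p}" using i(1) by (auto simp: r_def)
  moreover have "sorted_wrt (<) r"
    unfolding r_def sorted_wrt_map by (rule sorted_wrt_filter) simp
  ultimately show "r \<in> increasing_tuples p m" by (simp add: increasing_tuples_def)
qed

subsection \<open>Projections\<close>

lemma proj_in_tensors: "proj n i T \<in> tensors (subtuple n i)"
  by (auto simp: proj_def tensors_def)

text \<open>Turns a sum over a fibre into a sum over the whole box with zeros off the fibre, a form
  that can be cut into lines or collapsed to a single point.\<close>

lemma proj_apply:
  assumes "a \<in> box (subtuple n i)"
  shows "proj n i T a = (\<Sum>b\<in>box n. if subtuple b i = a then T b else 0)"
  using assms by (simp add: proj_def sum.If_cases Int_def)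

text \<open>Grouping the points above \<open>a\<close> by their intermediate image
  \<open>subtuple b i\<close> splits the fibre of the composite projection into fibres of the first
  one.\<close>

lemma proj_proj:
  assumes "set i \<subseteq> {1..length n}" "set r \<subseteq> {1..length i}"
  shows "proj (subtuple n i) r (proj n i T) = proj n (subtuple i r) T"
proof
  fix a
  have nir: "subtuple (subtuple n i) r = subtuple n (subtuple i r)"
    by (rule subtuple_subtuple) (rule assms)
  show "proj (subtuple n i) r (proj n i T) a = proj n (subtuple i r) T a"
  proof (cases "a \<in> box (subtuple n (subtuple i r))")
    case True
    let ?B = "{b \<in> box n. subtuple b (subtuple i r) = a}"
    let ?C = "{c \<in> box (subtuple n i). subtuple c r = a}"
    have "proj (subtuple n i) r (proj n i T) a = (\<Sum>c\<in>?C. proj n i T c)"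
      using True by (simp add: proj_def nir)
    also have "\<dots> = (\<Sum>c\<in>?C. \<Sum>b\<in>{b \<in> ?B. subtuple b i = c}. T b)"
    proof (rule sum.cong[OF refl])
      fix c assume c: "c \<in> ?C"
      then have "{b \<in> box n. subtuple b i = c} = {b \<in> ?B. subtuple b i = c}"
        using subtuple_subtuple[OF assms(2)] by auto
      then show "proj n i T c = (\<Sum>b\<in>{b \<in> ?B. subtuple b i = c}. T b)"
        using c by (simp add: proj_def)
    qed
    also have "\<dots> = sum T ?B"
    proof (rule sum.group)
      show "(\<lambda>b. subtuple b i) ` ?B \<subseteq> ?C"
        using subtuple_in_box[OF _ assms(1)] subtuple_subtuple[OF assms(2)] by auto
    qed auto
    finally show ?thesis using True by (simp add: proj_def)
  next
    case False
    then show ?thesis by (simp add: proj_def nir)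
  qed
qed

lemma realisable_imp_realistic:
  assumes "realisable p n S"
  shows "realistic p n S"
  unfolding realistic_def
proof (intro ballI impI)
  obtain C where C: "\<And>i. i \<in> increasing_tuples (length n) p \<Longrightarrow> proj n i C = S i"
    using assms by (auto simp: realisable_def)
  fix i j r s
  assume i: "i \<in> increasing_tuples (length n) p" and j: "j \<in> increasing_tuples (length n) p"
    and r: "r \<in> increasing_tuples p (p - 1)" and s: "s \<in> increasing_tuples p (p - 1)"
    and eq: "subtuple i r = subtuple j s"
  have "proj (subtuple n i) r (S i) = proj n (subtuple i r) C"
    using proj_proj C[OF i] increasing_tuplesD[OF i] increasing_tuplesD[OF r] by metis
  moreover have "proj (subtuple n j) s (S j) = proj n (subtuple j s) C"
    using proj_proj C[OF j] increasing_tuplesD[OF j] increasing_tuplesD[OF s] by metis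
  ultimately show "proj (subtuple n i) r (S i) = proj (subtuple n j) s (S j)"
    using eq by simp
qed

subsection \<open>Tensors supported on a coordinate subspace\<close>

text \<open>The value 1 serves as base point of every mode outside \<open>i\<close>.
  \<open>Suc k\<close> appears because list positions start at 0 while the entries of
  \<open>i\<close> start at 1. Values off the box are left as they fall, since \<open>proj\<close>
  sums over the box only.\<close>

definition lift_tensor :: "nat list \<Rightarrow> nat list \<Rightarrow> (nat list \<Rightarrow> int) \<Rightarrow> nat list \<Rightarrow> int" where
  "lift_tensor n i D b =
     (if \<forall>k<length n. Suc k \<notin> set i \<longrightarrow> b ! k = 1 then D (subtuple b i) else 0)"

text \<open>Cuts the box into lines parallel to axis \<open>k\<close>. Each line is represented by
  its point with coordinate 1 there, which exists because the mode is nonempty.\<close>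

lemma sum_box_coordinate:
  fixes f :: "nat list \<Rightarrow> int"
  assumes k: "k < length n" and pos: "1 \<le> n ! k"
  shows "(\<Sum>b\<in>box n. f b) = (\<Sum>b\<in>{b \<in> box n. b ! k = 1}. \<Sum>x\<in>{1..n ! k}. f (b[k := x]))"
proof -
  have "(\<Sum>b\<in>{b \<in> box n. b ! k = 1}. \<Sum>x\<in>{1..n ! k}. f (b[k := x]))
      = (\<Sum>(b, x)\<in>{b \<in> box n. b ! k = 1} \<times> {1..n ! k}. f (b[k := x]))"
    by (simp add: sum.cartesian_product)
  also have "\<dots> = (\<Sum>b\<in>box n. f b)"
  proof (rule sum.reindex_bij_witness
      [where i = "\<lambda>b. (b[k := 1], b ! k)" and j = "\<lambda>(b, x). b[k := x]"])
    fix a assume "a \<in> {b \<in> box n. b ! k = 1} \<times> {1..n ! k}"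
    then obtain b x where a: "a = (b, x)" "b \<in> box n" "b ! k = 1" "x \<in> {1..n ! k}" by auto
    have "length b = length n" using a(2) by (simp add: box_def)
    moreover have "b[k := 1] = b" using a(3) by (metis list_update_id)
    ultimately show "(case a of (b, x) \<Rightarrow> b[k := x]) \<in> box n"
      "((case a of (b, x) \<Rightarrow> b[k := x])[k := 1], (case a of (b, x) \<Rightarrow> b[k := x]) ! k) = a"
      "f (case a of (b, x) \<Rightarrow> b[k := x]) = (case a of (b, x) \<Rightarrow> f (b[k := x]))"
      using a k list_update_in_box by auto
  next
    fix b assume b: "b \<in> box n"
    then have "length b = length n" "b ! k \<in> {1..n ! k}" using k by (auto simp: box_def)
    then show "(b[k := 1], b ! k) \<in> {b \<in> box n. b ! k = 1} \<times> {1..n ! k}"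
      using b k pos list_update_in_box[OF b, of 1 k] by auto
    show "(case (b[k := 1], b ! k) of (b, x) \<Rightarrow> b[k := x]) = b" by simp
  qed
  finally show ?thesis ..
qed

text \<open>Above each \<open>a\<close> the support contains exactly one point of the box: it copies
  \<open>a\<close> on the coordinates in \<open>i\<close> and is 1 elsewhere. Positivity of the
  modes puts this point, called \<open>b\<close> below, inside the box.\<close>

lemma proj_lift_tensor_same:
  assumes "\<forall>m\<in>set n. m \<ge> 1" "distinct i" "set i \<subseteq> {1..length n}"
    and "D \<in> tensors (subtuple n i)"
  shows "proj n i (lift_tensor n i D) = D"
proof
  fix a
  show "proj n i (lift_tensor n i D) a = D a"
  proof (cases "a \<in> box (subtuple n i)")
    case True
    then have len: "length a = length i" by (simp add: box_def)
    have a: "a ! j \<in> {1..n ! (i ! j - 1)}" if "j < length i" for j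
      using True that by (auto simp: box_def)
    \<comment> \<open>Inverse of the enumeration \<open>i\<close>: the position at which coordinate
      \<open>Suc k\<close> is listed. It is unique by distinctness and consulted only if
      \<open>Suc k\<close> occurs in \<open>i\<close>.\<close>
    define at where "at k = (THE j. j < length i \<and> i ! j = Suc k)" for k
    have at: "at k = j" if "j < length i" "i ! j = Suc k" for j k
      unfolding at_def using that assms(2) by (intro the_equality) (auto dest: nth_eq_iff_index_eq)
    define b where "b = map (\<lambda>k. if Suc k \<in> set i then a ! at k else 1) [0..<length n]"
    have i_nth: "i ! j \<in> {1..length n}" if "j < length i" for j
      using that assms(3) nth_mem by blast
    have b_in: "b ! (i ! j - 1) = a ! j" if j: "j < length i" for j
    proof -
      obtain k where k: "i ! j = Suc k" "k < length n"
        using i_nth[OF j] by (cases "i ! j") auto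
      then show ?thesis using at[OF j k(1)] nth_mem[OF j] by (simp add: b_def)
    qed
    have b_out: "b ! k = 1" if "k < length n" "Suc k \<notin> set i" for k
      using that by (simp add: b_def)
    have len_b: "length b = length n" by (simp add: b_def)
    have "b ! k \<in> {1..n ! k}" if k: "k < length n" for k
    proof (cases "Suc k \<in> set i")
      case True
      then obtain j where "j < length i" "i ! j = Suc k" by (auto simp: in_set_conv_nth)
      then show ?thesis using a[of j] b_in[of j] by simp
    next
      case False
      then show ?thesis using b_out k assms(1) by simp
    qed
    then have b_box: "b \<in> box n" using len_b by (simp add: box_def)
    have b_sub: "subtuple b i = a"
      using len b_in by (intro nth_equalityI) auto
    have uniq: "c = b" if c: "c \<in> box n" "subtuple c i = a"
      "\<forall>k<length n. Suc k \<notin> set i \<longrightarrow> c ! k = 1" for c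
    proof (rule nth_equalityI)
      show lc: "length c = length b" using c(1) len_b by (simp add: box_def)
      fix k assume "k < length c"
      then have k: "k < length n" using lc len_b by simp
      show "c ! k = b ! k"
      proof (cases "Suc k \<in> set i")
        case True
        then obtain j where j: "j < length i" "i ! j = Suc k" by (auto simp: in_set_conv_nth)
        then have "c ! k = a ! j" using c(2) nth_subtuple[of j i c] by simp
        then show ?thesis using b_in[of j] j by simp
      next
        case False
        then show ?thesis using b_out c(3) k by simp
      qed
    qed
    have "proj n i (lift_tensor n i D) a
        = (\<Sum>c\<in>box n. if c = b then D a else 0)"
      unfolding proj_apply[OF True]
    proof (rule sum.cong[OF refl])
      fix c assume "c \<in> box n"
      then have "subtuple c i = a \<and> (\<forall>k<length n. Suc k \<notin> set i \<longrightarrow> c ! k = 1) \<longleftrightarrow> c = b"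
        using uniq b_sub b_out by blast
      then show "(if subtuple c i = a then lift_tensor n i D c else 0) = (if c = b then D a else 0)"
        using b_sub by (cases "c = b") (auto simp: lift_tensor_def)
    qed
    also have "\<dots> = D a" using b_box by simp
    finally show ?thesis .
  next
    case False
    then show ?thesis using assms(4) by (auto simp: proj_def tensors_def)
  qed
qed

text \<open>A line parallel to axis \<open>j\<close> is exactly a fibre of the projection that
  forgets this axis, so vanishing marginals make every line sum zero.\<close>

lemma sum_coordinate_eq_0:
  assumes c: "c \<in> box m" and m: "length m = Suc p" and j: "j \<le> p"
    and van: "\<And>r a. r \<in> increasing_tuples (Suc p) p \<Longrightarrow> a \<in> box (subtuple m r)
      \<Longrightarrow> proj m r D a = 0"
  shows "(\<Sum>x\<in>{1..m ! j}. D (c[j := x])) = 0"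
proof -
  \<comment> \<open>All 1-based indices up to \<open>p + 1\<close> (the upper end of the range is
    exclusive) except that of axis \<open>j\<close>.\<close>
  define r where "r = filter (\<lambda>t. t \<noteq> Suc j) [1..<p + 2]"
  have set_r: "set r = {1..Suc p} - {Suc j}" by (auto simp: r_def)
  have "length r = card (set r)"
    unfolding r_def by (rule distinct_card[symmetric]) simp
  also have "\<dots> = p" using j by (simp add: set_r)
  finally have "length r = p" .
  moreover have "sorted_wrt (<) r"
    unfolding r_def by (rule sorted_wrt_filter, rule sorted_wrt_upt)
  ultimately have r: "r \<in> increasing_tuples (Suc p) p"
    by (auto simp: increasing_tuples_def set_r)
  have len_c: "length c = Suc p" using c m by (simp add: box_def)
  have fibre: "{b \<in> box m. subtuple b r = subtuple c r} = (\<lambda>x. c[j := x]) ` {1..m ! j}"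
  proof (intro set_eqI iffI)
    fix b assume b: "b \<in> {b \<in> box m. subtuple b r = subtuple c r}"
    have "b = c[j := b ! j]"
    proof (rule nth_equalityI)
      show "length b = length (c[j := b ! j])" using b c by (simp add: box_def)
      fix k assume "k < length b"
      then have k: "k < Suc p" using b m by (simp add: box_def)
      show "b ! k = c[j := b ! j] ! k"
      proof (cases "k = j")
        case False
        then have "Suc k \<in> set r" using k by (simp add: set_r)
        then have "b ! k = c ! k" using b by (force simp: subtuple_def)
        then show ?thesis using False by simp
      qed (use len_c k in simp)
    qed
    moreover have "b ! j \<in> {1..m ! j}" using b m j by (simp add: box_def)
    ultimately show "b \<in> (\<lambda>x. c[j := x]) ` {1..m ! j}" by blast
  next
    fix b assume "b \<in> (\<lambda>x. c[j := x]) ` {1..m ! j}"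
    then obtain x where x: "b = c[j := x]" "x \<in> {1..m ! j}" by blast
    moreover have "subtuple (c[j := x]) r = subtuple c r"
      unfolding subtuple_def
    proof (rule map_cong[OF refl])
      fix t assume "t \<in> set r"
      then have "t - 1 \<noteq> j" by (auto simp: set_r)
      then show "c[j := x] ! (t - 1) = c ! (t - 1)" by simp
    qed
    ultimately show "b \<in> {b \<in> box m. subtuple b r = subtuple c r}"
      using list_update_in_box[OF c] by simp
  qed
  have inj: "inj_on (\<lambda>x. c[j := x]) {1..m ! j}"
  proof (rule inj_onI)
    fix x y assume "c[j := x] = c[j := y]"
    then have "c[j := x] ! j = c[j := y] ! j" by simp
    then show "x = y" using len_c j by simp
  qed
  have "subtuple c r \<in> box (subtuple m r)"
    using c m set_r by (intro subtuple_in_box) auto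
  then have "(\<Sum>b\<in>{b \<in> box m. subtuple b r = subtuple c r}. D b) = 0"
    using van[OF r, of "subtuple c r"] by (simp add: proj_def)
  then show ?thesis unfolding fibre sum.reindex[OF inj] by simp
qed

text \<open>Some coordinate \<open>k\<close> belongs to \<open>i\<close> but not to
  \<open>i'\<close>. Moving \<open>b\<close> along axis \<open>k\<close> changes neither its image
  under \<open>i'\<close> nor its membership in the support, while \<open>subtuple b i\<close> runs
  through a line on which \<open>D\<close> sums to zero. The projection is a sum over such
  lines.\<close>

lemma proj_lift_tensor_other:
  assumes pos: "\<forall>m\<in>set n. m \<ge> 1"
    and i: "i \<in> increasing_tuples (length n) (Suc p)"
    and i': "i' \<in> increasing_tuples (length n) (Suc p)" and "i \<noteq> i'"
    and van: "\<And>r a. r \<in> increasing_tuples (Suc p) p \<Longrightarrow> a \<in> box (subtuple (subtuple n i) r)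
      \<Longrightarrow> proj (subtuple n i) r D a = 0"
    and a: "a \<in> box (subtuple n i')"
  shows "proj n i' (lift_tensor n i D) a = 0"
proof -
  note I = increasing_tuplesD[OF i] and I' = increasing_tuplesD[OF i']
  have "\<not> set i \<subseteq> set i'"
  proof
    assume "set i \<subseteq> set i'"
    then have "set i = set i'"
      using I(1,4) I'(1,4) by (intro card_subset_eq) (auto simp: distinct_card)
    then show False using \<open>i \<noteq> i'\<close> increasing_tuples_eqI[OF i i'] by blast
  qed
  then obtain j where j: "j < length i" "i ! j \<notin> set i'"
    by (auto simp: in_set_conv_nth subset_iff)
  define k where "k = i ! j - 1"
  have "i ! j \<in> {1..length n}" using j(1) I(2) nth_mem by blast
  then have ij: "i ! j = Suc k" and k: "k < length n" by (auto simp: k_def)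
  have upd': "subtuple (b[k := x]) i' = subtuple b i'" for b x
    unfolding subtuple_def
  proof (rule map_cong[OF refl])
    fix t assume "t \<in> set i'"
    then have "t \<noteq> Suc k" "1 \<le> t" using j(2) ij I'(2) by auto
    then show "b[k := x] ! (t - 1) = b ! (t - 1)" by (simp add: nth_list_update)
  qed
  \<comment> \<open>Since \<open>i\<close> is distinct, changing coordinate \<open>k\<close> affects
    only the entry at position \<open>j\<close>.\<close>
  have upd: "subtuple (b[k := x]) i = (subtuple b i)[j := x]" if "length b = length n" for b x
  proof (rule nth_equalityI)
    fix l assume "l < length (subtuple (b[k := x]) i)"
    then have l: "l < length i" by simp
    then have "i ! l \<in> {1..length n}" using I(2) nth_mem by blast
    moreover have "i ! l = Suc k \<longleftrightarrow> l = j"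
      using I(4) l j(1) ij by (metis nth_eq_iff_index_eq)
    ultimately have "i ! l - 1 = k \<longleftrightarrow> l = j" by auto
    then show "subtuple (b[k := x]) i ! l = (subtuple b i)[j := x] ! l"
      using l j(1) k that by (auto simp: nth_list_update)
  qed simp
  have cond: "(\<forall>l<length n. Suc l \<notin> set i \<longrightarrow> b[k := x] ! l = 1)
      \<longleftrightarrow> (\<forall>l<length n. Suc l \<notin> set i \<longrightarrow> b ! l = 1)" for b x
    using ij nth_mem[OF j(1)] by (metis nth_list_update_neq)
  have "proj n i' (lift_tensor n i D) a
      = (\<Sum>b\<in>{b \<in> box n. b ! k = 1}. \<Sum>x\<in>{1..n ! k}.
          if subtuple (b[k := x]) i' = a then lift_tensor n i D (b[k := x]) else 0)"
    unfolding proj_apply[OF a] using pos k by (intro sum_box_coordinate) auto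
  also have "\<dots> = 0"
  proof (rule sum.neutral, rule ballI)
    fix b assume "b \<in> {b \<in> box n. b ! k = 1}"
    then have b: "b \<in> box n" "length b = length n" by (auto simp: box_def)
    have "(\<Sum>x\<in>{1..subtuple n i ! j}. D ((subtuple b i)[j := x])) = 0"
      by (rule sum_coordinate_eq_0[OF subtuple_in_box[OF b(1) I(2)] _ _ van]) (use j I(1) in auto)
    then have "(\<Sum>x\<in>{1..n ! k}. D ((subtuple b i)[j := x])) = 0"
      using j(1) by (simp add: k_def)
    \<comment> \<open>\<open>A\<close> stands for the fibre condition and \<open>B\<close> for the
      support condition. Both are constant along the line, so the sum is either trivially 0 or the
      full line sum of \<open>D\<close>.\<close>
    then have "(\<Sum>x\<in>{1..n ! k}. if A then if B then D ((subtuple b i)[j := x]) else 0 else 0) = 0"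
      for A B by (cases A; cases B) simp_all
    then show "(\<Sum>x\<in>{1..n ! k}.
        if subtuple (b[k := x]) i' = a then lift_tensor n i D (b[k := x]) else 0) = 0"
      unfolding lift_tensor_def cond upd' upd[OF b(2)] .
  qed
  finally show ?thesis .
qed

subsection \<open>Marginals of realistic systems\<close>

text \<open>The bound on \<open>Suc p\<close> ensures that every \<open>p\<close>-subset has a
  superset of size \<open>p + 1\<close> from which to take a marginal. The last conclusion is what
  later makes the marginals of the defects vanish.\<close>

lemma realistic_marginals:
  assumes q: "Suc p \<le> length n" and real: "realistic (Suc p) n S"
  obtains M where "M \<in> shadow_systems p n" "realistic p n M"
    and "\<And>i r. i \<in> increasing_tuples (length n) (Suc p) \<Longrightarrow> r \<in> increasing_tuples (Suc p) p
      \<Longrightarrow> M (subtuple i r) = proj (subtuple n i) r (S i)"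
proof -
  let ?q = "length n"
  \<comment> \<open>\<open>P J T\<close> says that \<open>T\<close> arises as a marginal on
    \<open>J\<close> from some shadow. Realism makes \<open>T\<close> unique, so the choice made in
    \<open>M\<close> does not depend on the shadow used.\<close>
  define P where "P J T \<longleftrightarrow> (\<exists>i\<in>increasing_tuples ?q (Suc p). \<exists>r\<in>increasing_tuples (Suc p) p.
    subtuple i r = J \<and> T = proj (subtuple n i) r (S i))" for J T
  define M where "M = (\<lambda>J\<in>increasing_tuples ?q p. SOME T. P J T)"
  have M: "M (subtuple i r) = proj (subtuple n i) r (S i)"
    if i: "i \<in> increasing_tuples ?q (Suc p)" and r: "r \<in> increasing_tuples (Suc p) p" for i r
  proof -
    have "P (subtuple i r) T \<longleftrightarrow> T = proj (subtuple n i) r (S i)" for T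
      unfolding P_def using real i r unfolding realistic_def by (metis diff_Suc_1)
    then have "(SOME T. P (subtuple i r) T) = proj (subtuple n i) r (S i)"
      by (intro some_equality) simp_all
    then show ?thesis
      using subtuple_increasing[OF i r] by (simp add: M_def)
  qed
  have super: "\<exists>i\<in>increasing_tuples ?q (Suc p). \<exists>r\<in>increasing_tuples (Suc p) p. subtuple i r = J"
    if J: "J \<in> increasing_tuples ?q p" for J
  proof -
    note JD = increasing_tuplesD[OF J]
    have cJ: "card (set J) = p" using JD by (simp add: distinct_card)
    obtain x where x: "x \<in> {1..?q}" "x \<notin> set J"
    proof -
      have "\<not> {1..?q} \<subseteq> set J"
        using card_mono[of "set J" "{1..?q}"] cJ q by auto
      then show thesis using that by blast
    qed
    let ?i = "sorted_list_of_set (insert x (set J))"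
    have i: "?i \<in> increasing_tuples ?q (Suc p)"
      using increasing_tuple_of_set[of "insert x (set J)" ?q] x JD(2) cJ by simp
    obtain r where "r \<in> increasing_tuples (Suc p) p" "subtuple ?i r = J"
      by (rule subtuple_of_subset[OF i J]) (auto simp del: sorted_list_of_set_insert_remove)
    then show ?thesis using i by blast
  qed
  have shadow: "M \<in> shadow_systems p n"
    unfolding shadow_systems_def
  proof (rule PiE_I)
    fix J assume "J \<in> increasing_tuples ?q p"
    then obtain i r where ir: "i \<in> increasing_tuples ?q (Suc p)" "r \<in> increasing_tuples (Suc p) p"
      "subtuple i r = J" using super by blast
    have "set r \<subseteq> {1..length i}" using increasing_tuplesD[OF ir(1)] increasing_tuplesD[OF ir(2)] by simp
    then show "M J \<in> tensors (subtuple n J)"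
      using M[OF ir(1,2)] ir(3) proj_in_tensors[of "subtuple n i" r] subtuple_subtuple by metis
  qed (simp add: M_def)
  have "realistic p n M"
    unfolding realistic_def
  proof (intro ballI impI)
    fix J J' r s
    assume J: "J \<in> increasing_tuples ?q p" and J': "J' \<in> increasing_tuples ?q p"
      and r: "r \<in> increasing_tuples p (p - 1)" and s: "s \<in> increasing_tuples p (p - 1)"
      and eq: "subtuple J r = subtuple J' s"
    note JD = increasing_tuplesD[OF J] and J'D = increasing_tuplesD[OF J']
    note rD = increasing_tuplesD[OF r] and sD = increasing_tuplesD[OF s]
    show "proj (subtuple n J) r (M J) = proj (subtuple n J') s (M J')"
    proof (cases "J = J'")
      case True
      \<comment> \<open>This case includes \<open>p = 0\<close>, where the empty tuple is the only
        index and \<open>p - 1\<close> is truncated to 0.\<close>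
      then have "r = s" using subtuple_cancel[of J r s] JD rD sD eq by simp
      then show ?thesis using True by simp
    next
      case False
      have cJ: "card (set J) = p" "card (set J') = p"
        using JD J'D by (simp_all add: distinct_card)
      have sub: "set (subtuple J r) \<subseteq> set J \<inter> set J'"
      proof -
        have "set (subtuple L u) \<subseteq> set L" if "set u \<subseteq> {1..length L}" for L u :: "nat list"
          using that by (force simp: subtuple_def)
        then have "set (subtuple J r) \<subseteq> set J" "set (subtuple J' s) \<subseteq> set J'"
          using rD sD JD J'D by simp_all
        then show ?thesis using eq by simp
      qed
      have "card (set (subtuple J r)) = p - 1"
        using increasing_tuplesD[OF subtuple_increasing[OF J r]] by (simp add: distinct_card)
      \<comment> \<open>The common subtuple gives at least \<open>p - 1\<close> shared entries.
        Distinct sets of size \<open>p\<close> share fewer than \<open>p\<close>, so the union has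
        exactly \<open>p + 1\<close> elements and indexes a shadow \<open>S I\<close>.\<close>
      then have lower: "p - 1 \<le> card (set J \<inter> set J')"
        using card_mono[OF _ sub] by simp
      have "card (set J \<inter> set J') \<noteq> p"
      proof
        assume "card (set J \<inter> set J') = p"
        then have "set J \<inter> set J' = set J" "set J \<inter> set J' = set J'"
          using cJ by (intro card_subset_eq; simp)+
        then show False using False increasing_tuples_eqI[OF J J'] by blast
      qed
      moreover have "card (set J \<inter> set J') \<le> p"
        using card_mono[of "set J" "set J \<inter> set J'"] cJ by simp
      ultimately have "Suc (card (set J \<inter> set J')) = p" using lower by simp
      then have card: "card (set J \<union> set J') = Suc p"
        using card_Un_Int[of "set J" "set J'"] cJ by simp
      define I where "I = sorted_list_of_set (set J \<union> set J')"
      have I: "I \<in> increasing_tuples ?q (Suc p)"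
        using increasing_tuple_of_set[of "set J \<union> set J'" ?q] JD(2) J'D(2) card
        by (simp add: I_def)
      note ID = increasing_tuplesD[OF I]
      obtain u where u: "u \<in> increasing_tuples (Suc p) p" "subtuple I u = J"
        by (rule subtuple_of_subset[OF I J]) (auto simp: I_def)
      obtain v where v: "v \<in> increasing_tuples (Suc p) p" "subtuple I v = J'"
        by (rule subtuple_of_subset[OF I J']) (auto simp: I_def)
      note uD = increasing_tuplesD[OF u(1)] and vD = increasing_tuplesD[OF v(1)]
      note urD = increasing_tuplesD[OF subtuple_increasing[OF u(1) r]]
        and vsD = increasing_tuplesD[OF subtuple_increasing[OF v(1) s]]
      have nJ: "subtuple n J = subtuple (subtuple n I) u"
        using subtuple_subtuple[of u I n] u(2) uD(2) ID(1) by simp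
      have nJ': "subtuple n J' = subtuple (subtuple n I) v"
        using subtuple_subtuple[of v I n] v(2) vD(2) ID(1) by simp
      \<comment> \<open>Seen from \<open>I\<close>, both sides select the same entries. Cancelling
        \<open>I\<close> shows that both marginals are one and the same projection of
        \<open>S I\<close>.\<close>
      have "subtuple I (subtuple u r) = subtuple I (subtuple v s)"
        using subtuple_subtuple[of r u I] subtuple_subtuple[of s v I] u(2) v(2) eq rD uD sD vD
        by simp
      then have uv: "subtuple u r = subtuple v s"
        using subtuple_cancel[of I] ID urD vsD by simp
      have "proj (subtuple n J) r (M J) = proj (subtuple n I) (subtuple u r) (S I)"
        unfolding nJ using M[OF I u(1)] u(2) proj_proj[of u "subtuple n I" r] uD rD ID by simp
      moreover have "proj (subtuple n J') s (M J') = proj (subtuple n I) (subtuple v s) (S I)"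
        unfolding nJ' using M[OF I v(1)] v(2) proj_proj[of v "subtuple n I" s] vD sD ID by simp
      ultimately show ?thesis using uv by simp
    qed
  qed
  then show thesis using that shadow M by blast
qed

section \<open>Induction on the number of modes of the shadows\<close>

lemma realistic_imp_realisable:
  assumes pos: "\<forall>m\<in>set n. m \<ge> 1"
    and "S \<in> shadow_systems p n" "realistic p n S"
  shows "realisable p n S"
  using assms(2,3)
proof (induction p arbitrary: S)
  case 0
  have inc: "increasing_tuples (length n) 0 = {[]}" by (auto simp: increasing_tuples_def)
  \<comment> \<open>For \<open>p = 0\<close> the system is a single integer, placed here at the
    all-ones point. The restriction makes the function a member of \<open>tensors n\<close>.\<close>
  define C where "C = restrict (lift_tensor n [] (S [])) (box n)"
  have "proj n [] C = proj n [] (lift_tensor n [] (S []))"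
    by (auto simp: proj_def C_def intro!: restrict_ext sum.cong)
  also have "\<dots> = S []"
    using pos 0 inc by (intro proj_lift_tensor_same) (auto simp: shadow_systems_def)
  finally show ?case
    unfolding realisable_def inc by (auto simp: tensors_def C_def intro!: bexI[of _ C])
next
  case (Suc p)
  let ?I = "increasing_tuples (length n) (Suc p)"
  show ?case
  proof (cases "Suc p \<le> length n")
    case False
    \<comment> \<open>With more modes requested than available there are no shadows to match, and
      the zero tensor will do.\<close>
    have "?I = {}"
    proof (rule equals0I)
      fix i assume "i \<in> ?I"
      note iD = increasing_tuplesD[OF this]
      then have "Suc p = card (set i)" by (simp add: distinct_card)
      also have "\<dots> \<le> length n" using card_mono[OF _ iD(2)] by simp
      finally show False using False by simp
    qed
    then show ?thesis
      by (auto simp: realisable_def tensors_def intro!: bexI[of _ "\<lambda>b\<in>box n. 0"])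
  next
    case True
    obtain M where M: "M \<in> shadow_systems p n" "realistic p n M"
      and M_sub: "\<And>i r. i \<in> ?I \<Longrightarrow> r \<in> increasing_tuples (Suc p) p
        \<Longrightarrow> M (subtuple i r) = proj (subtuple n i) r (S i)"
      using realistic_marginals[OF True Suc.prems(2)] by blast
    obtain C where C: "\<And>J. J \<in> increasing_tuples (length n) p \<Longrightarrow> proj n J C = M J"
      using Suc.IH[OF M] by (auto simp: realisable_def)
    define D where "D i = (\<lambda>a\<in>box (subtuple n i). S i a - proj n i C a)" for i
    define E where "E = (\<lambda>b\<in>box n. C b + (\<Sum>i\<in>?I. lift_tensor n i (D i) b))"
    \<comment> \<open>\<open>C\<close> realises \<open>M\<close>, the system of marginals of
      \<open>S\<close>, so \<open>S i\<close> and the projection of \<open>C\<close> along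
      \<open>i\<close> have equal marginals.\<close>
    have D_van: "proj (subtuple n i) r (D i) a = 0"
      if i: "i \<in> ?I" and r: "r \<in> increasing_tuples (Suc p) p"
        and a: "a \<in> box (subtuple (subtuple n i) r)" for i r a
    proof -
      note iD = increasing_tuplesD[OF i] and rD = increasing_tuplesD[OF r]
      have "proj (subtuple n i) r (D i) a
          = proj (subtuple n i) r (S i) a - proj (subtuple n i) r (proj n i C) a"
        using a by (simp add: proj_def[of "subtuple n i"] D_def sum_subtractf)
      also have "proj (subtuple n i) r (proj n i C) = proj n (subtuple i r) C"
        using iD rD by (intro proj_proj) auto
      also have "\<dots> = proj (subtuple n i) r (S i)"
        using C M_sub[OF i r] subtuple_increasing[OF i r] by simp
      finally show ?thesis by simp
    qed
    have "proj n i E = S i" if i: "i \<in> ?I" for i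
    proof
      note iD = increasing_tuplesD[OF i]
      fix a
      show "proj n i E a = S i a"
      proof (cases "a \<in> box (subtuple n i)")
        case True
        have "proj n i E a
            = proj n i C a + (\<Sum>b\<in>{b \<in> box n. subtuple b i = a}. \<Sum>i'\<in>?I. lift_tensor n i' (D i') b)"
          using True by (simp add: proj_def E_def sum.distrib)
        also have "(\<Sum>b\<in>{b \<in> box n. subtuple b i = a}. \<Sum>i'\<in>?I. lift_tensor n i' (D i') b)
            = (\<Sum>i'\<in>?I. proj n i (lift_tensor n i' (D i')) a)"
          using True by (subst sum.swap) (simp add: proj_def)
        \<comment> \<open>The corrections do not interfere: along \<open>i\<close> only the lift of
          \<open>D i\<close> survives, and it supplies exactly what \<open>C\<close> is missing
          there.\<close>
        also have "\<dots> = (\<Sum>i'\<in>?I. if i' = i then D i a else 0)"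
        proof (rule sum.cong[OF refl])
          fix i' assume i': "i' \<in> ?I"
          show "proj n i (lift_tensor n i' (D i')) a = (if i' = i then D i a else 0)"
          proof (cases "i' = i")
            case True
            have "D i \<in> tensors (subtuple n i)" by (auto simp: D_def tensors_def)
            then show ?thesis
              using True proj_lift_tensor_same[OF pos iD(4,2)] by simp
          next
            case False
            then show ?thesis
              using proj_lift_tensor_other[OF pos i' i False D_van[OF i'] True] by simp
          qed
        qed
        also have "\<dots> = D i a" using i by simp
        finally show ?thesis using True by (simp add: D_def)
      next
        case False
        have "S i \<in> tensors (subtuple n i)"
          using Suc.prems(1) i by (auto simp: shadow_systems_def)
        then show ?thesis using False by (auto simp: proj_def tensors_def)
      qed
    qed
    moreover have "E \<in> tensors n" by (simp add: E_def tensors_def)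
    ultimately show ?thesis unfolding realisable_def by blast
  qed
qed

theorem theorem5p7:
  fixes p q :: nat and n :: "nat list" and S :: "nat list \<Rightarrow> nat list \<Rightarrow> int"
  assumes "p \<ge> 1" and "q \<ge> 1"
    and "length n = q" and "\<forall>m\<in>set n. m \<ge> 1"
    and "S \<in> shadow_systems p n"
  shows "realistic p n S \<longleftrightarrow> realisable p n S"
  using realistic_imp_realisable[OF assms(4,5)] realisable_imp_realistic by blast

end
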